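(* Let $G$ be a graph of order $n\ge 3$. Then: (a) If $\Delta(G)\le\sqrt{2n}$, then $G$ has distinct vertices $u,v$ with $\mathrm{Tri}_G(u)=\mathrm{Tri}_G(v)$. (b) If $\delta(G)>n-1-(2n/3)^{1/3}$, then $G$ has two distinct vertices $u,v$ with $d_G(u)=d_G(v)$ and $\mathrm{Tri}_G(u)=\mathrm{Tri}_G(v)$. (c) If $G$ is $d$-regular and triangle-distinct, then $\sqrt{2n}<d\le n-\sqrt{2n/3}$.
   Context: All graphs are finite and simple. $\Delta(G)$ and $\delta(G)$ are the maximum and minimum degree of $G$, and $d_G(u)$ is the degree of $u$. $\mathrm{Tri}_G(u)$ (the triangle-degree of $u$) is the number of triangles of $G$ containing $u$. A graph is triangle-distinct if it has at least two vertices and the triangle-degrees of its vertices are pairwise distinct. *)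

theory Defs
  imports Complex_Main "Graph_Theory.Pair_Digraph"
begin

text \<open>
  Finite simple graphs are the members of the locale \<open>pair_graph\<close>: finite, loop-free, symmetric
  digraphs without parallel arcs. An undirected edge \<open>uv\<close> is represented by the two arcs
  \<open>(u, v)\<close> and \<open>(v, u)\<close>, so the degree of a vertex is its out-degree (equally, its in-degree).
\<close>

definition degree :: "'a pair_pre_digraph \<Rightarrow> 'a \<Rightarrow> nat" where
  "degree G u = out_degree (with_proj G) u"

text \<open>
  The next two are meaningful only for a nonempty finite vertex set (\<open>Max\<close> and \<open>Min\<close> are
  unspecified on the empty set).
\<close>

definition max_degree :: "'a pair_pre_digraph \<Rightarrow> nat" where
  "max_degree G = Max (degree G ` pverts G)"

definition min_degree :: "'a pair_pre_digraph \<Rightarrow> nat" where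
  "min_degree G = Min (degree G ` pverts G)"

definition regular :: "'a pair_pre_digraph \<Rightarrow> nat \<Rightarrow> bool" where
  "regular G d \<longleftrightarrow> (\<forall>u\<in>pverts G. degree G u = d)"

text \<open>A triangle is identified with its set of three vertices, so it is counted without order.\<close>

definition triangles :: "'a pair_pre_digraph \<Rightarrow> 'a set set" where
  "triangles G = {T. T \<subseteq> pverts G \<and> card T = 3 \<and> (\<forall>x\<in>T. \<forall>y\<in>T. x \<noteq> y \<longrightarrow> (x, y) \<in> parcs G)}"

definition tri_degree :: "'a pair_pre_digraph \<Rightarrow> 'a \<Rightarrow> nat" where
  "tri_degree G u = card {T \<in> triangles G. u \<in> T}"

definition triangle_distinct :: "'a pair_pre_digraph \<Rightarrow> bool" where
  "triangle_distinct G \<longleftrightarrow> card (pverts G) \<ge> 2 \<and> inj_on (tri_degree G) (pverts G)"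

end

theory Submission
  imports Defs
begin

text \<open>
  For (a), \<open>Tri(u)\<close> is at most \<open>d(u) choose 2\<close>, so \<open>n\<close> distinct triangle-degrees force
  \<open>n - 1 \<le> \<Delta>(\<Delta> - 1) / 2\<close>.

  For (b) and the upper bound in (c), consider the complement \<open>H\<close> of \<open>G\<close>, with \<open>m\<close> edges and
  maximum degree \<open>D = n - 1 - \<delta>\<close>. The pairs of neighbours of \<open>u\<close> in \<open>G\<close> that do not form a triangle
  with \<open>u\<close> are the edges of \<open>H\<close> avoiding \<open>u\<close> and its \<open>H\<close>-neighbours. Hence, for a vertex \<open>u\<close> with
  \<open>k\<close> neighbours in \<open>H\<close>, \<open>Tri(u) + m = (d(u) choose 2) + k + t(u)\<close>, where \<open>t(u)\<close> counts the edges of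
  \<open>H\<close> that avoid \<open>u\<close> but meet an \<open>H\<close>-neighbour of \<open>u\<close>. Since \<open>t(u) \<le> k (D - 1)\<close>, there are few
  possible pairs \<open>(d(u), Tri(u))\<close>: at most \<open>\<Sum>k\<le>D. k (D - 1) + 1\<close> in all, and at most
  \<open>D (D - 1) + 1\<close> if \<open>G\<close> is regular.
\<close>

section \<open>Neighbourhoods and the complement of \<open>G\<close>\<close>

definition neighbours :: "'a pair_pre_digraph \<Rightarrow> 'a \<Rightarrow> 'a set" where
  "neighbours G u = {v \<in> pverts G. (u, v) \<in> parcs G}"

definition non_neighbours :: "'a pair_pre_digraph \<Rightarrow> 'a \<Rightarrow> 'a set" where
  "non_neighbours G u = {v \<in> pverts G. v \<noteq> u \<and> (u, v) \<notin> parcs G}"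

text \<open>The edge set of \<open>H\<close>, as unordered pairs so that each edge counts once
  although a graph carries two arcs per edge.\<close>

definition non_edges :: "'a pair_pre_digraph \<Rightarrow> 'a set set" where
  "non_edges G = {e. \<exists>x\<in>pverts G. \<exists>y\<in>pverts G. x \<noteq> y \<and> (x, y) \<notin> parcs G \<and> e = {x, y}}"

text \<open>The edges counted by \<open>t(u)\<close>.\<close>

definition second_non_edges :: "'a pair_pre_digraph \<Rightarrow> 'a \<Rightarrow> 'a set set" where
  "second_non_edges G u = {e \<in> non_edges G. u \<notin> e \<and> e \<inter> non_neighbours G u \<noteq> {}}"

context pair_graph
begin

lemma arc_sym: "(x, y) \<in> parcs G \<longleftrightarrow> (y, x) \<in> parcs G"
  using arcs_symmetric by blast

lemma arc_irrefl: "(x, x) \<notin> parcs G"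
  using no_loops by fastforce

lemma finite_neighbours: "finite (neighbours G u)"
  by (simp add: neighbours_def)

lemma finite_non_neighbours: "finite (non_neighbours G u)"
  by (simp add: non_neighbours_def)

lemma finite_non_edges: "finite (non_edges G)"
  by (rule finite_subset[of _ "Pow (pverts G)"]) (auto simp: non_edges_def)

lemma degree_eq_card_neighbours: "degree G u = card (neighbours G u)"
proof -
  have "out_arcs (with_proj G) u = Pair u ` neighbours G u"
    using in_arcsD2 by (auto simp: out_arcs_def neighbours_def)
  then show ?thesis
    by (simp add: degree_def out_degree_def card_image inj_on_def)
qed

lemma degree_add_card_non_neighbours:
  assumes "u \<in> pverts G"
  shows "degree G u + card (non_neighbours G u) + 1 = card (pverts G)"
proof -
  have "pverts G = insert u (neighbours G u \<union> non_neighbours G u)"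
    using assms by (auto simp: neighbours_def non_neighbours_def)
  moreover have "u \<notin> neighbours G u \<union> non_neighbours G u"
    using arc_irrefl by (auto simp: neighbours_def non_neighbours_def)
  moreover have "neighbours G u \<inter> non_neighbours G u = {}"
    by (auto simp: neighbours_def non_neighbours_def)
  ultimately show ?thesis
    by (metis Suc_eq_plus1 card_Un_disjoint card_insert_disjoint degree_eq_card_neighbours
        finite_Un finite_neighbours finite_non_neighbours)
qed

section \<open>Triangle-degrees in terms of the complement\<close>

lemma tri_degree_eq_card_pairs:
  assumes "u \<in> pverts G"
  shows "tri_degree G u = card {e. e \<subseteq> neighbours G u \<and> card e = 2 \<and> e \<notin> non_edges G}"
    (is "_ = card ?P")
proof -
  \<comment> \<open>Deleting \<open>u\<close> from a triangle through \<open>u\<close> leaves an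
    adjacent pair of neighbours of \<open>u\<close>, and adding \<open>u\<close> back inverts
    this.\<close>
  have "bij_betw (insert u) ?P {T \<in> triangles G. u \<in> T}"
  proof (rule bij_betw_byWitness[where f' = "\<lambda>T. T - {u}"])
    show "\<forall>e\<in>?P. insert u e - {u} = e"
      using arc_irrefl by (auto simp: neighbours_def)
    show "\<forall>T\<in>{T \<in> triangles G. u \<in> T}. insert u (T - {u}) = T"
      by auto
    show "insert u ` ?P \<subseteq> {T \<in> triangles G. u \<in> T}"
    proof safe
      fix e assume e: "e \<subseteq> neighbours G u" "card e = 2" "e \<notin> non_edges G"
      then obtain x y where xy: "e = {x, y}" "x \<noteq> y"
        by (auto simp: card_2_iff)
      with e have arcs: "x \<in> pverts G" "y \<in> pverts G" "(u, x) \<in> parcs G" "(u, y) \<in> parcs G"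
        "(x, y) \<in> parcs G"
        by (auto simp: neighbours_def non_edges_def)
      then have "x \<noteq> u" "y \<noteq> u"
        using arc_irrefl by auto
      with xy arcs assms show "insert u e \<in> triangles G"
        using arc_sym by (auto simp: triangles_def)
    qed
    show "(\<lambda>T. T - {u}) ` {T \<in> triangles G. u \<in> T} \<subseteq> ?P"
      by (auto simp: triangles_def neighbours_def non_edges_def card_Diff_singleton)
  qed
  then show ?thesis
    by (simp add: tri_degree_def bij_betw_same_card)
qed

lemma tri_degree_add_card_non_edges_neighbours:
  assumes "u \<in> pverts G"
  shows "tri_degree G u + card {e \<in> non_edges G. e \<subseteq> neighbours G u} = degree G u choose 2"
proof -
  let ?P = "{e. e \<subseteq> neighbours G u \<and> card e = 2 \<and> e \<notin> non_edges G}"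
  let ?Q = "{e \<in> non_edges G. e \<subseteq> neighbours G u}"
  have "{e. e \<subseteq> neighbours G u \<and> card e = 2} = ?P \<union> ?Q"
    by (auto simp: non_edges_def)
  moreover have "finite ?P" "finite ?Q" "?P \<inter> ?Q = {}"
    using finite_neighbours[of u] finite_non_edges by auto
  ultimately have "card {e. e \<subseteq> neighbours G u \<and> card e = 2} = card ?P + card ?Q"
    by (simp add: card_Un_disjoint)
  then show ?thesis
    using assms by (simp add: n_subsets finite_neighbours degree_eq_card_neighbours
        tri_degree_eq_card_pairs)
qed

lemma card_non_edges_at:
  assumes "u \<in> pverts G"
  shows "card {e \<in> non_edges G. u \<in> e} = card (non_neighbours G u)"
proof -
  have "{e \<in> non_edges G. u \<in> e} = (\<lambda>v. {u, v}) ` non_neighbours G u"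
    using assms arc_sym by (auto simp: non_edges_def non_neighbours_def)
  moreover have "inj_on (\<lambda>v. {u, v}) (non_neighbours G u)"
    by (auto simp: inj_on_def doubleton_eq_iff)
  ultimately show ?thesis
    by (simp add: card_image)
qed

text \<open>Every edge of \<open>H\<close> lies within the neighbours of \<open>u\<close>, contains
  \<open>u\<close>, or avoids \<open>u\<close> and meets a non-neighbour. As the total is the same
  for all \<open>u\<close>, the degree and \<open>t(u)\<close> determine the
  triangle-degree.\<close>

lemma tri_degree_add_card_non_edges:
  assumes "u \<in> pverts G"
  shows "tri_degree G u + card (non_edges G) =
    (degree G u choose 2) + card (non_neighbours G u) + card (second_non_edges G u)"
proof -
  let ?A = "{e \<in> non_edges G. e \<subseteq> neighbours G u}"
  let ?B = "{e \<in> non_edges G. u \<in> e}"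
  let ?C = "second_non_edges G u"
  have fin: "finite ?A" "finite ?B" "finite ?C"
    using finite_non_edges by (auto simp: second_non_edges_def)
  have "non_edges G = ?A \<union> ?B \<union> ?C"
    by (auto simp: second_non_edges_def non_edges_def neighbours_def non_neighbours_def)
  moreover have "?A \<inter> ?B = {}" "(?A \<union> ?B) \<inter> ?C = {}"
    using arc_irrefl by (auto simp: second_non_edges_def neighbours_def non_neighbours_def)
  ultimately have "card (non_edges G) = card ?A + card ?B + card ?C"
    using fin card_Un_disjoint[of ?A ?B] card_Un_disjoint[of "?A \<union> ?B" ?C]
    by (simp only: finite_Un simp_thms)
  with tri_degree_add_card_non_edges_neighbours[OF assms] card_non_edges_at[OF assms]
  show ?thesis
    by linarith
qed

text \<open>Union bound over the \<open>H\<close>-neighbours \<open>w\<close> of \<open>u\<close>;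
  an edge joining two of them is counted twice, which is harmless.\<close>

lemma card_second_non_edges_le:
  assumes u: "u \<in> pverts G"
    and D: "\<And>w. w \<in> pverts G \<Longrightarrow> card (non_neighbours G w) \<le> D"
  shows "card (second_non_edges G u) \<le> card (non_neighbours G u) * (D - 1)"
proof -
  let ?N = "non_neighbours G u"
  have "card {e \<in> non_edges G. w \<in> e \<and> u \<notin> e} \<le> D - 1" if w: "w \<in> ?N" for w
  proof -
    have wV: "w \<in> pverts G"
      using w by (simp add: non_neighbours_def)
    \<comment> \<open>The edge \<open>{u, w}\<close> of \<open>H\<close> contains \<open>u\<close>
      and is therefore excluded, so at most \<open>D - 1\<close> edges at \<open>w\<close>
      remain.\<close>
    have mem: "{u, w} \<in> {e \<in> non_edges G. w \<in> e}"
      unfolding non_edges_def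
      using w u by (simp add: non_neighbours_def) (rule bexI[of _ u], rule bexI[of _ w], auto)
    have "card {e \<in> non_edges G. w \<in> e \<and> u \<notin> e} \<le> card ({e \<in> non_edges G. w \<in> e} - {{u, w}})"
      by (rule card_mono) (simp add: finite_non_edges, blast)
    also have "\<dots> = card (non_neighbours G w) - 1"
      using card_non_edges_at[OF wV] mem by (simp add: card_Diff_singleton)
    finally show ?thesis
      using D[OF wV] by linarith
  qed
  then have "(\<Sum>w\<in>?N. card {e \<in> non_edges G. w \<in> e \<and> u \<notin> e}) \<le> card ?N * (D - 1)"
    using sum_bounded_above[of ?N _ "D - 1"] by simp
  moreover have "second_non_edges G u = (\<Union>w\<in>?N. {e \<in> non_edges G. w \<in> e \<and> u \<notin> e})"
    by (auto simp: second_non_edges_def)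
  ultimately show ?thesis
    using card_UN_le[OF finite_non_neighbours, of "\<lambda>w. {e \<in> non_edges G. w \<in> e \<and> u \<notin> e}" u]
    by simp
qed

text \<open>The pair \<open>(k, t(u))\<close> determines degree and triangle-degree, so distinct
  vertices have distinct such pairs. The set \<open>K\<close> of admissible \<open>k\<close> is
  \<open>{..D}\<close> for (b) and \<open>{D}\<close> for regular graphs.\<close>

lemma card_verts_le_if_inj:
  assumes inj: "inj_on (\<lambda>u. (degree G u, tri_degree G u)) (pverts G)"
    and K: "finite K" "\<And>u. u \<in> pverts G \<Longrightarrow> card (non_neighbours G u) \<in> K"
    and D: "\<And>k. k \<in> K \<Longrightarrow> k \<le> D"
  shows "card (pverts G) \<le> (\<Sum>k\<in>K. k * (D - 1) + 1)"
proof -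
  let ?f = "\<lambda>u. (card (non_neighbours G u), card (second_non_edges G u))"
  have "inj_on ?f (pverts G)"
  proof (rule inj_onI)
    fix u v assume uv: "u \<in> pverts G" "v \<in> pverts G" and eq: "?f u = ?f v"
    have deg: "degree G u = degree G v"
      using degree_add_card_non_neighbours[OF uv(1)] degree_add_card_non_neighbours[OF uv(2)] eq
      by simp
    then have "tri_degree G u = tri_degree G v"
      using tri_degree_add_card_non_edges[OF uv(1)] tri_degree_add_card_non_edges[OF uv(2)] eq
      by simp
    with deg uv inj show "u = v"
      by (auto dest: inj_onD)
  qed
  moreover have "?f ` pverts G \<subseteq> (SIGMA k:K. {..k * (D - 1)})"
    using K(2) D card_second_non_edges_le[of _ D] by auto
  ultimately have "card (pverts G) \<le> card (SIGMA k:K. {..k * (D - 1)})"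
    using K(1) by (intro card_inj_on_le) auto
  then show ?thesis
    using K(1) by (simp add: card_SigmaI)
qed

section \<open>The degree bounds\<close>

lemma degree_le_max_degree: "u \<in> pverts G \<Longrightarrow> degree G u \<le> max_degree G"
  by (simp add: max_degree_def)

lemma min_degree_le_degree: "u \<in> pverts G \<Longrightarrow> min_degree G \<le> degree G u"
  by (simp add: min_degree_def)

lemma card_verts_le_if_inj_tri_degree:
  assumes inj: "inj_on (tri_degree G) (pverts G)"
  shows "card (pverts G) \<le> (max_degree G choose 2) + 1"
proof -
  have "tri_degree G ` pverts G \<subseteq> {..max_degree G choose 2}"
  proof (rule image_subsetI)
    fix u assume u: "u \<in> pverts G"
    have "tri_degree G u \<le> degree G u choose 2"
      using tri_degree_add_card_non_edges_neighbours[OF u] by linarith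
    also have "\<dots> \<le> max_degree G choose 2"
      using degree_le_max_degree[OF u] by (simp add: choose_two div_le_mono mult_le_mono)
    finally show "tri_degree G u \<in> {..max_degree G choose 2}"
      by simp
  qed
  from card_inj_on_le[OF inj this] show ?thesis
    by simp
qed

text \<open>The contrapositive of (a), and also the lower bound in (c), where
  \<open>max_degree G\<close> is \<open>d\<close>.\<close>

lemma sqrt_less_max_degree:
  assumes inj: "inj_on (tri_degree G) (pverts G)" and n: "card (pverts G) \<ge> 3"
  shows "sqrt (2 * real (card (pverts G))) < max_degree G"
proof -
  let ?n = "card (pverts G)" and ?D = "max_degree G"
  have "2 * ?n \<le> ?D * (?D - 1) + 2"
    using card_verts_le_if_inj_tri_degree[OF inj] by (simp add: choose_two)
  \<comment> \<open>For \<open>?D \<le> 2\<close> the right side above is at most 4, but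
    \<open>2 * ?n \<ge> 6\<close>. With \<open>?D > 2\<close>, \<open>?D * (?D - 1) + 2\<close> is
    strictly below the square of \<open>?D\<close>.\<close>
  moreover from this n have "?D \<ge> 3"
    by (cases ?D; cases "?D - 1"; cases "?D - 2") auto
  ultimately have "2 * ?n < ?D\<^sup>2"
    by (cases ?D) (auto simp: power2_eq_square)
  then have "2 * real ?n < (real ?D)\<^sup>2"
    by (metis of_nat_less_iff of_nat_mult of_nat_numeral of_nat_power)
  then show ?thesis
    by (intro real_less_lsqrt) auto
qed

lemma min_degree_le:
  assumes inj: "inj_on (\<lambda>u. (degree G u, tri_degree G u)) (pverts G)"
    and n: "card (pverts G) \<ge> 3"
  shows "real (min_degree G) \<le> real (card (pverts G)) - 1 - root 3 (2 * real (card (pverts G)) / 3)"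
proof -
  let ?n = "card (pverts G)"
  define D where "D = ?n - 1 - min_degree G"
  have nonnbrs: "card (non_neighbours G u) \<le> D" if "u \<in> pverts G" for u
    using degree_add_card_non_neighbours[OF that] min_degree_le_degree[OF that]
    unfolding D_def by linarith
  obtain u where u: "u \<in> pverts G"
    using n by fastforce
  \<comment> \<open>Any vertex witnesses \<open>min_degree G \<le> ?n - 1\<close>, so the natural
    subtraction in \<open>D\<close> does not truncate.\<close>
  have D_eq: "real (min_degree G) = real ?n - 1 - real D"
    using min_degree_le_degree[OF u] degree_add_card_non_neighbours[OF u]
    unfolding D_def by linarith
  have "?n \<le> (\<Sum>k\<le>D. k * (D - 1) + 1)"
    using inj nonnbrs by (intro card_verts_le_if_inj) auto
  also have "\<dots> = (D * (D + 1) div 2) * (D - 1) + (D + 1)"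
    using gauss_sum_nat[of D]
    unfolding sum.distrib sum_distrib_right[symmetric] by (simp add: atLeast0AtMost)
  finally have "2 * ?n \<le> 2 * ((D * (D + 1) div 2) * (D - 1) + (D + 1))"
    by (rule mult_le_mono2)
  then have "2 * ?n \<le> 2 * (D * (D + 1) div 2) * (D - 1) + 2 * (D + 1)"
    by (simp only: distrib_left mult.assoc)
  also have "2 * (D * (D + 1) div 2) = D * (D + 1)"
    by simp
  finally have bound: "2 * ?n \<le> D * (D + 1) * (D - 1) + 2 * (D + 1)" .
  \<comment> \<open>The values 0 and 1 would give \<open>?n \<le> 1\<close> and
    \<open>?n \<le> 2\<close>.\<close>
  then have "D \<noteq> 0" "D \<noteq> 1"
    using n by auto
  then obtain m where m: "D = m + 2"
    by (metis One_nat_def add_2_eq_Suc' not0_implies_Suc)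
  \<comment> \<open>The right side of \<open>bound\<close> equals \<open>D ^ 3 + D + 2\<close>,
    which is at most \<open>3 * D ^ 3\<close> once \<open>D \<ge> 2\<close>.\<close>
  have "2 * ?n \<le> 3 * D ^ 3"
    using bound by (simp add: m power3_eq_cube algebra_simps)
  then have "real (2 * ?n) \<le> real (3 * D ^ 3)"
    by (rule of_nat_mono)
  then have "root 3 (2 * real ?n / 3) \<le> root 3 (real D ^ 3)"
    by simp
  then have "root 3 (2 * real ?n / 3) \<le> D"
    by (simp add: real_root_power_cancel)
  with D_eq show ?thesis
    by linarith
qed

lemma regular_degree_le:
  assumes reg: "regular G d" and inj: "inj_on (tri_degree G) (pverts G)"
    and n: "card (pverts G) \<ge> 3"
  shows "real d \<le> real (card (pverts G)) - sqrt (2 * real (card (pverts G)) / 3)"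
proof -
  let ?n = "card (pverts G)"
  define D where "D = ?n - 1 - d"
  have nonnbrs: "d + D + 1 = ?n \<and> card (non_neighbours G u) = D" if "u \<in> pverts G" for u
    using degree_add_card_non_neighbours[OF that] that reg
    unfolding D_def regular_def by force
  obtain u where u: "u \<in> pverts G"
    using n by fastforce
  have "inj_on (\<lambda>u. (degree G u, tri_degree G u)) (pverts G)"
    using inj by (auto simp: inj_on_def)
  then have "?n \<le> (\<Sum>k\<in>{D}. k * (D - 1) + 1)"
    using nonnbrs by (intro card_verts_le_if_inj) auto
  also have "\<dots> = D * (D - 1) + 1"
    by simp
  \<comment> \<open>Since \<open>D + 1 = ?n - d\<close>, bounding \<open>?n\<close> by this square
    suffices: \<open>2 * ?n / 3 \<le> ?n\<close>.\<close>
  also have "\<dots> \<le> (D + 1)\<^sup>2"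
    by (cases D) (auto simp: power2_eq_square)
  finally have "real ?n \<le> (real (D + 1))\<^sup>2"
    by (metis of_nat_le_iff of_nat_power)
  then have "sqrt (2 * real ?n / 3) \<le> real (D + 1)"
    by (intro real_le_lsqrt) auto
  then show ?thesis
    using nonnbrs[OF u] by linarith
qed

end

theorem theorem5:
  fixes G :: "'a pair_pre_digraph" and n :: nat
  assumes "pair_graph G"
    and "card (pverts G) = n"
    and "n \<ge> 3"
  shows "(real (max_degree G) \<le> sqrt (2 * real n) \<longrightarrow>
            (\<exists>u\<in>pverts G. \<exists>v\<in>pverts G. u \<noteq> v \<and> tri_degree G u = tri_degree G v))
       \<and> (real (min_degree G) > real n - 1 - root 3 (2 * real n / 3) \<longrightarrow>
            (\<exists>u\<in>pverts G. \<exists>v\<in>pverts G. u \<noteq> v \<and>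
               degree G u = degree G v \<and> tri_degree G u = tri_degree G v))
       \<and> (\<forall>d. regular G d \<and> triangle_distinct G \<longrightarrow>
            sqrt (2 * real n) < real d \<and> real d \<le> real n - sqrt (2 * real n / 3))"
proof -
  interpret pair_graph G by fact
  note n = assms(2)
  have n3: "card (pverts G) \<ge> 3"
    using assms(2,3) by simp
  have a: "\<exists>u\<in>pverts G. \<exists>v\<in>pverts G. u \<noteq> v \<and> tri_degree G u = tri_degree G v"
    if "real (max_degree G) \<le> sqrt (2 * real n)"
    using that sqrt_less_max_degree[OF _ n3] unfolding n inj_on_def by fastforce
  have b: "\<exists>u\<in>pverts G. \<exists>v\<in>pverts G. u \<noteq> v \<and>
      degree G u = degree G v \<and> tri_degree G u = tri_degree G v"
    if "real (min_degree G) > real n - 1 - root 3 (2 * real n / 3)"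
    using that min_degree_le[OF _ n3] unfolding n inj_on_def by fastforce
  have c: "sqrt (2 * real n) < real d \<and> real d \<le> real n - sqrt (2 * real n / 3)"
    if "regular G d" "triangle_distinct G" for d
  proof -
    have inj: "inj_on (tri_degree G) (pverts G)"
      using that(2) by (simp add: triangle_distinct_def)
    \<comment> \<open>Nonemptiness makes the image of \<open>degree G\<close> the singleton
      \<open>{d}\<close> instead of the empty set, where \<open>Max\<close> is unspecified.\<close>
    have "pverts G \<noteq> {}"
      using n3 by auto
    then have "degree G ` pverts G = {d}"
      using that(1) by (auto simp: regular_def)
    then have "max_degree G = d"
      by (simp add: max_degree_def)
    with sqrt_less_max_degree[OF inj n3] regular_degree_le[OF that(1) inj n3] show ?thesis
      by (simp add: n)
  qed
  from a b c show ?thesis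
    by blast
qed

end
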